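(* Let $\delta\in\mathbb C^\times$ and let $(\mathcal A,\cdot)$ be an algebra over $\mathbb C$ (not necessarily associative; $xy$ denotes $x\cdot y$). Define $$x\ast y=\frac{xy-yx}{2},\qquad \{x,y\}=\frac{xy+yx}{2}.$$ Then $(\mathcal A,\cdot)$ is a $\delta$-weak anti-Leibniz algebra if and only if $(\mathcal A,\ast,\{-,-\})$ is a transposed $\delta$-mock-Poisson algebra.
   Context: An algebra $(\mathcal A,\cdot)$ is a $\delta$-weak anti-Leibniz algebra if for all $x,y,z\in\mathcal A$ $$\delta\bigl((xy)z+(yx)z\bigr)+(\delta+1)\bigl(x(yz)+y(xz)\bigr)+(\delta-1)\bigl(x(zy)+y(zx)\bigr)=0,$$ $$(\delta+1)\bigl((xy)z+(xz)y\bigr)+(\delta-1)\bigl((yx)z+(zx)y\bigr)+\delta\,x(yz+zy)=0.$$ A mock-Lie algebra is a vector space with a symmetric bilinear product $\{-,-\}$ satisfying $\{\{x,y\},z\}+\{\{y,z\},x\}+\{\{z,x\},y\}=0$. A transposed $\delta$-mock-Poisson algebra is a triple $(\mathcal A,\ast,\{-,-\})$ where $(\mathcal A,\ast)$ is anti-commutative ($x\ast y=-y\ast x$) and anti-associative ($(x\ast y)\ast z=-x\ast(y\ast z)$), $(\mathcal A,\{-,-\})$ is a mock-Lie algebra, and for all $x,y,z\in\mathcal A$ $$-2\delta\,x\ast\{y,z\}=\{x\ast y,z\}+\{y,x\ast z\}.$$ *)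

theory Defs
  imports Complex_Main
begin

locale complex_algebra = vector_space scale
  for scale :: "complex \<Rightarrow> 'a::ab_group_add \<Rightarrow> 'a" (infixr \<open>*s\<close> 75) +
  fixes mul :: "'a \<Rightarrow> 'a \<Rightarrow> 'a" (infixl \<open>\<bullet>\<close> 80)
  assumes linear_left: "Vector_Spaces.linear scale scale (\<lambda>x. x \<bullet> y)"
    and linear_right: "Vector_Spaces.linear scale scale (\<lambda>y. x \<bullet> y)"

locale weak_anti_leibniz_algebra = complex_algebra scale mul
  for \<delta> :: complex
    and scale :: "complex \<Rightarrow> 'a::ab_group_add \<Rightarrow> 'a" (infixr \<open>*s\<close> 75)
    and mul :: "'a \<Rightarrow> 'a \<Rightarrow> 'a" (infixl \<open>\<bullet>\<close> 80) +
  assumes weak_anti_leibniz_left: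
    "\<delta> *s ((x \<bullet> y) \<bullet> z + (y \<bullet> x) \<bullet> z)
       + (\<delta> + 1) *s (x \<bullet> (y \<bullet> z) + y \<bullet> (x \<bullet> z))
       + (\<delta> - 1) *s (x \<bullet> (z \<bullet> y) + y \<bullet> (z \<bullet> x)) = 0"
    and weak_anti_leibniz_right:
    "(\<delta> + 1) *s ((x \<bullet> y) \<bullet> z + (x \<bullet> z) \<bullet> y)
       + (\<delta> - 1) *s ((y \<bullet> x) \<bullet> z + (z \<bullet> x) \<bullet> y)
       + \<delta> *s (x \<bullet> (y \<bullet> z + z \<bullet> y)) = 0"

locale mock_lie_algebra = complex_algebra scale brk
  for scale :: "complex \<Rightarrow> 'a::ab_group_add \<Rightarrow> 'a" (infixr \<open>*s\<close> 75)
    and brk :: "'a \<Rightarrow> 'a \<Rightarrow> 'a" +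
  assumes brk_sym: "brk x y = brk y x"
    and brk_jacobi: "brk (brk x y) z + brk (brk y z) x + brk (brk z x) y = 0"

locale anticomm_antiassoc_algebra = complex_algebra scale star
  for scale :: "complex \<Rightarrow> 'a::ab_group_add \<Rightarrow> 'a" (infixr \<open>*s\<close> 75)
    and star :: "'a \<Rightarrow> 'a \<Rightarrow> 'a" (infixl \<open>\<star>\<close> 80) +
  assumes anticomm: "x \<star> y = - (y \<star> x)"
    and antiassoc: "(x \<star> y) \<star> z = - (x \<star> (y \<star> z))"

locale transposed_mock_poisson_algebra =
  anticomm_antiassoc_algebra scale star + mock_lie_algebra scale brk
  for \<delta> :: complex
    and scale :: "complex \<Rightarrow> 'a::ab_group_add \<Rightarrow> 'a" (infixr \<open>*s\<close> 75)
    and star :: "'a \<Rightarrow> 'a \<Rightarrow> 'a" (infixl \<open>\<star>\<close> 80)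
    and brk :: "'a \<Rightarrow> 'a \<Rightarrow> 'a" +
  assumes transposed_leibniz:
    "(- 2 * \<delta>) *s (x \<star> brk y z) = brk (x \<star> y) z + brk y (x \<star> z)"

definition skew_product ::
    "(complex \<Rightarrow> 'a::ab_group_add \<Rightarrow> 'a) \<Rightarrow> ('a \<Rightarrow> 'a \<Rightarrow> 'a) \<Rightarrow> 'a \<Rightarrow> 'a \<Rightarrow> 'a"
  where "skew_product scale mul x y = scale (1 / 2) (mul x y - mul y x)"

definition sym_product ::
    "(complex \<Rightarrow> 'a::ab_group_add \<Rightarrow> 'a) \<Rightarrow> ('a \<Rightarrow> 'a \<Rightarrow> 'a) \<Rightarrow> 'a \<Rightarrow> 'a \<Rightarrow> 'a"
  where "sym_product scale mul x y = scale (1 / 2) (mul x y + mul y x)"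

end

theory Submission
  imports Defs
begin

text \<open>
  Write \<open>xy = x \<star> y + {x,y}\<close>, and let \<open>J\<close> be the Jacobi sum of \<open>x, y, z\<close>. Expanding the two weak
  anti-Leibniz identities, the left one at \<open>(x,y,z)\<close> and the right one at \<open>(z,x,y)\<close> are twice
  \<open>S + D\<close> and \<open>S - D\<close>, where \<open>S = \<delta>J + x\<star>(y\<star>z) + y\<star>(x\<star>z)\<close> and
  \<open>D = \<delta>(x\<star>{y,z} + y\<star>{x,z} - z\<star>{x,y}) + {x,y\<star>z} + {y,x\<star>z}\<close>. So they say that \<open>S\<close> and \<open>D\<close>
  vanish identically. Adding the three cyclic shifts of \<open>S = 0\<close> leaves \<open>3\<delta>J = 0\<close>, hence
  \<open>J = 0\<close> because \<open>\<delta> \<noteq> 0\<close>, and then \<open>S = 0\<close> is anti-associativity. Adding two cyclic shifts of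
  \<open>D = 0\<close> gives the transposed Leibniz rule, and an alternating sum of three of those gives \<open>D = 0\<close>
  back.
\<close>

context complex_algebra
begin

abbreviation star :: "'a \<Rightarrow> 'a \<Rightarrow> 'a" (infixl \<open>\<star>\<close> 80)
  where "star \<equiv> skew_product scale mul"

abbreviation brk :: "'a \<Rightarrow> 'a \<Rightarrow> 'a"
  where "brk \<equiv> sym_product scale mul"

abbreviation jacobi_sum :: "'a \<Rightarrow> 'a \<Rightarrow> 'a \<Rightarrow> 'a"
  where "jacobi_sum x y z \<equiv> brk (brk x y) z + brk (brk y z) x + brk (brk z x) y"

abbreviation weak_sum :: "complex \<Rightarrow> 'a \<Rightarrow> 'a \<Rightarrow> 'a \<Rightarrow> 'a"
  where "weak_sum \<delta> x y z \<equiv> \<delta> *s jacobi_sum x y z + (x \<star> (y \<star> z) + y \<star> (x \<star> z))"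

abbreviation weak_diff :: "complex \<Rightarrow> 'a \<Rightarrow> 'a \<Rightarrow> 'a \<Rightarrow> 'a"
  where "weak_diff \<delta> x y z \<equiv>
    \<delta> *s (x \<star> brk y z + y \<star> brk x z - z \<star> brk x y) + (brk x (y \<star> z) + brk y (x \<star> z))"

lemma scale_two: "2 *s v = v + v"
  using scale_left_distrib [of 1 1 v] by simp

lemma add_self_eq_zero_iff: "v + v = 0 \<longleftrightarrow> v = 0"
  for v :: 'a
  using scale_eq_0_iff [of 2 v] by (simp add: scale_two)

lemma half_double: "(1 / 2) *s (v + v) = v"
  by (simp flip: scale_two)

lemma mul_add_left: "(x + y) \<bullet> z = x \<bullet> z + y \<bullet> z"
  and mul_scale_left: "(c *s x) \<bullet> z = c *s (x \<bullet> z)"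
  using linear_left [of z] by (auto simp: Vector_Spaces.linear_iff)

lemma mul_add_right: "x \<bullet> (y + z) = x \<bullet> y + x \<bullet> z"
  and mul_scale_right: "x \<bullet> (c *s y) = c *s (x \<bullet> y)"
  using linear_right [of x] by (auto simp: Vector_Spaces.linear_iff)

lemmas mul_bilinear = mul_add_left mul_scale_left mul_add_right mul_scale_right

lemma mul_minus_right: "x \<bullet> (- y) = - (x \<bullet> y)"
  using mul_scale_right [of x "- 1" y] by simp

lemma mul_diff_left: "(x - y) \<bullet> z = x \<bullet> z - y \<bullet> z"
  using mul_add_left [of "x - y" y z] by (simp add: algebra_simps)

lemma mul_diff_right: "x \<bullet> (y - z) = x \<bullet> y - x \<bullet> z"
  using mul_add_right [of x "y - z" z] by (simp add: algebra_simps)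

lemmas mul_additive = mul_add_left mul_add_right mul_minus_right mul_diff_left mul_diff_right

lemmas scale_distribs = scale_right_distrib scale_left_distrib
  scale_right_diff_distrib scale_left_diff_distrib

lemma complex_algebra_skew_product: "complex_algebra scale star"
  by unfold_locales
    (auto simp: Vector_Spaces.linear_iff vector_space_axioms skew_product_def mul_bilinear
      scale_distribs algebra_simps)

lemma complex_algebra_sym_product: "complex_algebra scale brk"
  by unfold_locales
    (auto simp: Vector_Spaces.linear_iff vector_space_axioms sym_product_def mul_bilinear
      scale_distribs algebra_simps)

text \<open>Bilinearity of the derived products makes the rules proved for \<open>mul\<close> in
  this locale available for them too.\<close>

lemmas star_additive = complex_algebra.mul_additive [OF complex_algebra_skew_product]

lemmas star_minus_right = complex_algebra.mul_minus_right [OF complex_algebra_skew_product]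

lemmas brk_additive = complex_algebra.mul_additive [OF complex_algebra_sym_product]

lemmas brk_minus_right = complex_algebra.mul_minus_right [OF complex_algebra_sym_product]

lemma star_anticomm: "x \<star> y = - (y \<star> x)"
  by (simp add: skew_product_def flip: scale_minus_right)

lemma brk_comm: "brk x y = brk y x"
  by (simp add: sym_product_def add.commute)

lemma mul_eq_star_plus_brk: "x \<bullet> y = x \<star> y + brk x y"
  unfolding skew_product_def sym_product_def
  using half_double [of "x \<bullet> y"] by (simp add: scale_distribs)

lemma weak_anti_leibniz_left_eq:
  "\<delta> *s ((x \<bullet> y) \<bullet> z + (y \<bullet> x) \<bullet> z)
     + (\<delta> + 1) *s (x \<bullet> (y \<bullet> z) + y \<bullet> (x \<bullet> z))
     + (\<delta> - 1) *s (x \<bullet> (z \<bullet> y) + y \<bullet> (z \<bullet> x))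
   = 2 *s (weak_sum \<delta> x y z + weak_diff \<delta> x y z)"
  \<comment> \<open>The instances bring equal products into the same order of factors. Deleting
    \<open>scale_scale\<close> keeps \<open>2 *s (\<delta> *s v)\<close> from merging, so that
    \<open>scale_two\<close> can split it.\<close>
  by (simp add: mul_eq_star_plus_brk star_additive brk_additive scale_distribs scale_two
      star_anticomm [of y x] star_anticomm [of z x] star_anticomm [of z y]
      star_anticomm [of "x \<star> y" z] star_anticomm [of "brk x y" z]
      brk_comm [of y x] brk_comm [of z x] brk_comm [of z y]
      brk_comm [of "x \<star> y" z] brk_comm [of "brk x y" z]
      brk_comm [of "brk y z" x] brk_comm [of "brk x z" y]
      algebra_simps del: scale_scale)

text \<open>Reversing all products turns the left identity at \<open>x y z\<close> into this one.
  Reversal negates \<open>\<star>\<close> and fixes \<open>brk\<close>; each term of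
  \<open>weak_sum\<close> has an even number of \<open>\<star>\<close>, each term of
  \<open>weak_diff\<close> exactly one, so only the sign of \<open>weak_diff\<close>
  changes.\<close>

lemma weak_anti_leibniz_right_eq:
  "(\<delta> + 1) *s ((z \<bullet> x) \<bullet> y + (z \<bullet> y) \<bullet> x)
     + (\<delta> - 1) *s ((x \<bullet> z) \<bullet> y + (y \<bullet> z) \<bullet> x)
     + \<delta> *s (z \<bullet> (x \<bullet> y + y \<bullet> x))
   = 2 *s (weak_sum \<delta> x y z - weak_diff \<delta> x y z)"
  \<comment> \<open>Signs are extracted from right factors only, hence the extra instances that move
    a negated left factor to the right.\<close>
  by (simp add: mul_eq_star_plus_brk star_additive brk_additive scale_distribs scale_two
      star_anticomm [of y x] star_anticomm [of z x] star_anticomm [of z y]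
      star_anticomm [of "x \<star> z" y] star_anticomm [of "y \<star> z" x]
      star_anticomm [of "- (x \<star> z)" y] star_anticomm [of "- (y \<star> z)" x]
      star_anticomm [of "brk x z" y] star_anticomm [of "brk y z" x]
      brk_comm [of y x] brk_comm [of z x] brk_comm [of z y]
      brk_comm [of "x \<star> z" y] brk_comm [of "y \<star> z" x]
      brk_comm [of "- (x \<star> z)" y] brk_comm [of "- (y \<star> z)" x]
      brk_comm [of "brk x y" z] brk_comm [of "brk y z" x] brk_comm [of "brk x z" y]
      algebra_simps del: scale_scale)

lemma sum_diff_eq_zero_iff: "u + v = 0 \<and> u - v = 0 \<longleftrightarrow> u = 0 \<and> v = 0"
  for u v :: 'a
  using add_self_eq_zero_iff [of u] by auto

lemma weak_anti_leibniz_iff: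
  "weak_anti_leibniz_algebra \<delta> scale mul \<longleftrightarrow>
    (\<forall>x y z. weak_sum \<delta> x y z = 0 \<and> weak_diff \<delta> x y z = 0)"
proof -
  have "weak_anti_leibniz_algebra \<delta> scale mul \<longleftrightarrow>
    (\<forall>x y z. 2 *s (weak_sum \<delta> x y z + weak_diff \<delta> x y z) = 0)
    \<and> (\<forall>z x y. 2 *s (weak_sum \<delta> x y z - weak_diff \<delta> x y z) = 0)"
    unfolding weak_anti_leibniz_algebra_def weak_anti_leibniz_algebra_axioms_def
      weak_anti_leibniz_left_eq weak_anti_leibniz_right_eq
    using complex_algebra_axioms by simp
  also have "\<dots> \<longleftrightarrow> (\<forall>x y z. weak_sum \<delta> x y z + weak_diff \<delta> x y z = 0
    \<and> weak_sum \<delta> x y z - weak_diff \<delta> x y z = 0)"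
    unfolding scale_eq_0_iff by auto
  finally show ?thesis
    unfolding sum_diff_eq_zero_iff .
qed

lemma transposed_mock_poisson_iff:
  "transposed_mock_poisson_algebra \<delta> scale star brk \<longleftrightarrow>
    (\<forall>x y z. (x \<star> y) \<star> z = - (x \<star> (y \<star> z))) \<and> (\<forall>x y z. jacobi_sum x y z = 0)
    \<and> (\<forall>x y z. (- 2 * \<delta>) *s (x \<star> brk y z) = brk (x \<star> y) z + brk y (x \<star> z))"
  unfolding transposed_mock_poisson_algebra_def transposed_mock_poisson_algebra_axioms_def
    anticomm_antiassoc_algebra_def anticomm_antiassoc_algebra_axioms_def
    mock_lie_algebra_def mock_lie_algebra_axioms_def
  using complex_algebra_skew_product complex_algebra_sym_product star_anticomm brk_comm
  by blast

lemma weak_sum_eq_zero_iff: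
  assumes "\<delta> \<noteq> 0"
  shows "(\<forall>x y z. weak_sum \<delta> x y z = 0) \<longleftrightarrow>
    (\<forall>x y z. (x \<star> y) \<star> z = - (x \<star> (y \<star> z))) \<and> (\<forall>x y z. jacobi_sum x y z = 0)"
proof (intro iffI conjI allI)
  assume sum: "\<forall>x y z. weak_sum \<delta> x y z = 0"
  show jacobi: "jacobi_sum x y z = 0" for x y z
  proof -
    \<comment> \<open>The Jacobi sum is invariant under cyclic shifts, while the six
      \<open>\<star>\<close> terms cancel in pairs such as \<open>x \<star> (y \<star> z)\<close>
      and \<open>x \<star> (z \<star> y)\<close>.\<close>
    have "3 *s (\<delta> *s jacobi_sum x y z)
      = weak_sum \<delta> x y z + weak_sum \<delta> y z x + weak_sum \<delta> z x y"
      using scale_left_distrib [of 2 1 "\<delta> *s jacobi_sum x y z"]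
      by (simp add: scale_two scale_distribs star_anticomm [of y x] star_anticomm [of z x]
          star_anticomm [of z y] star_minus_right algebra_simps del: scale_scale)
    with sum assms show ?thesis
      by (simp del: scale_scale)
  qed
  show "(x \<star> y) \<star> z = - (x \<star> (y \<star> z))" for x y z
  proof -
    have "z \<star> (x \<star> y) + x \<star> (z \<star> y) = 0"
      using sum jacobi [of z x y] by (metis add_0 scale_zero_right)
    then show ?thesis
      by (simp add: star_anticomm [of "x \<star> y" z] star_anticomm [of z y] star_minus_right)
  qed
next
  fix x y z
  assume "(\<forall>x y z. (x \<star> y) \<star> z = - (x \<star> (y \<star> z))) \<and> (\<forall>x y z. jacobi_sum x y z = 0)"
  \<comment> \<open>Anti-associativity turns the two terms into
    \<open>- ((x \<star> y) \<star> z)\<close> and \<open>- ((y \<star> x) \<star> z)\<close>, which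
    cancel.\<close>
  moreover from this have "x \<star> (y \<star> z) + y \<star> (x \<star> z) = 0"
    by (metis add.commute ab_left_minus star_anticomm star_minus_right)
  ultimately show "weak_sum \<delta> x y z = 0"
    by simp
qed

lemma weak_diff_eq_zero_iff:
  "(\<forall>x y z. weak_diff \<delta> x y z = 0) \<longleftrightarrow>
    (\<forall>x y z. (- 2 * \<delta>) *s (x \<star> brk y z) = brk (x \<star> y) z + brk y (x \<star> z))"
proof -
  let ?T = "\<lambda>x y z. 2 *s (\<delta> *s (x \<star> brk y z)) + (brk (x \<star> y) z + brk y (x \<star> z))"
  have T_iff: "(- 2 * \<delta>) *s (x \<star> brk y z) = brk (x \<star> y) z + brk y (x \<star> z) \<longleftrightarrow> ?T x y z = 0"
    for x y z
    by (simp add: neg_eq_iff_add_eq_0)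
  \<comment> \<open>In these two shifts \<open>z \<star> brk x y\<close> occurs with a plus sign
    both times, and the other two \<open>\<star>\<close> products with opposite signs. The brackets
    of \<open>z\<close> with \<open>x \<star> y\<close> and \<open>y \<star> x\<close>
    cancel.\<close>
  have T_eq: "?T z x y = weak_diff \<delta> y z x + weak_diff \<delta> z x y" for x y z
    by (simp add: scale_two scale_distribs
        star_anticomm [of y x] star_anticomm [of z x] star_anticomm [of z y]
        brk_comm [of y x] brk_comm [of z x] brk_comm [of z y]
        brk_comm [of "- (x \<star> z)" y]
        brk_minus_right algebra_simps del: scale_scale)
  \<comment> \<open>The signs are those of the three \<open>\<delta>\<close> terms in
    \<open>weak_diff\<close>. The brackets containing \<open>x \<star> y\<close> cancel and the
    others double.\<close>
  have diff_eq: "weak_diff \<delta> x y z + weak_diff \<delta> x y z = ?T x y z + ?T y z x - ?T z x y" for x y z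
    by (simp add: scale_two scale_distribs
        star_anticomm [of y x] star_anticomm [of z x] star_anticomm [of z y]
        brk_comm [of y x] brk_comm [of z x] brk_comm [of z y]
        brk_comm [of "x \<star> y" z] brk_comm [of "y \<star> z" x] brk_comm [of "- (x \<star> z)" y]
        brk_minus_right algebra_simps del: scale_scale)
  show ?thesis
    unfolding T_iff
  proof (intro iffI allI)
    fix x y z
    assume "\<forall>x y z. weak_diff \<delta> x y z = 0"
    then show "?T x y z = 0"
      unfolding T_eq by simp
  next
    fix x y z
    assume "\<forall>x y z. ?T x y z = 0"
    then have "weak_diff \<delta> x y z + weak_diff \<delta> x y z = 0"
      unfolding diff_eq by simp
    then show "weak_diff \<delta> x y z = 0"
      by (simp only: add_self_eq_zero_iff)
  qed
qed

end

theorem theorem6p17: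
  fixes \<delta> :: complex
    and scale :: "complex \<Rightarrow> 'a::ab_group_add \<Rightarrow> 'a"
    and mul :: "'a \<Rightarrow> 'a \<Rightarrow> 'a"
  assumes "\<delta> \<noteq> 0"
    and "complex_algebra scale mul"
  shows "weak_anti_leibniz_algebra \<delta> scale mul \<longleftrightarrow>
    transposed_mock_poisson_algebra \<delta> scale (skew_product scale mul) (sym_product scale mul)"
proof -
  interpret complex_algebra scale mul
    by fact
  show ?thesis
    unfolding weak_anti_leibniz_iff transposed_mock_poisson_iff
    using weak_sum_eq_zero_iff [OF \<open>\<delta> \<noteq> 0\<close>] weak_diff_eq_zero_iff [of \<delta>] by blast
qed

end
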